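(* Let $\mathcal{A}_1:\mathcal{G}\to\mathcal{S}_1$ and $\mathcal{A}_2:\mathcal{G}\times\mathcal{S}_1\to\mathcal{S}_2$ be randomized algorithms. Suppose that the average sensitivity of $\mathcal{A}_1$ with respect to the total variation distance is $\gamma_1$, and that for every $S_1\in\mathcal{S}_1$ the average sensitivity of $\mathcal{A}_2(\cdot,S_1)$ (with respect to the earth mover's distance) is $\beta_2^{(S_1)}$. Let $\mathcal{A}:\mathcal{G}\to\mathcal{S}_2$ be defined by $\mathcal{A}(G)=\mathcal{A}_2(G,\mathcal{A}_1(G))$. Then for every graph $G=(V,E)$ the average sensitivity of $\mathcal{A}$ at $G$ is at most $$\mathsf{H}\cdot\gamma_1(G)+\mathbb{E}_{S_1\sim\mathcal{A}_1(G)}\bigl[\beta_2^{(S_1)}(G)\bigr],$$ where $\mathsf{H}$ is the maximum Hamming weight (cardinality) among the solutions obtainable by running $\mathcal{A}$ on $G$ and on the graphs $G-e$, $e\in E$.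
   Context: $\mathcal{G}$ is the set of all finite undirected graphs; $G-e$ is $G$ with edge $e$ deleted. Solutions in $\mathcal{S}_2$ are sets (subsets of edges or vertices), compared via Hamming distance (size of symmetric difference); $d_{\mathrm{EM}}$ is the earth mover's distance with respect to Hamming distance and $d_{\mathrm{TV}}$ the total variation distance. For a randomized algorithm $\mathcal{B}$ with output distribution $\mathcal{B}(G)$, its average sensitivity at $G$ is $\mathbb{E}_{e\sim E}[d_{\mathrm{EM}}(\mathcal{B}(G),\mathcal{B}(G-e))]$ and its average sensitivity with respect to total variation distance is $\mathbb{E}_{e\sim E}[d_{\mathrm{TV}}(\mathcal{B}(G),\mathcal{B}(G-e))]$, $e$ uniform in $E$. For $\mathcal{A}_2(\cdot,S_1)$ the second argument $S_1$ is held fixed when passing from $G$ to $G-e$.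
   Formalization: Total variation distance is taken unhalved, as the sum of |p(x)-q(x)| (values up to 2); with the usual factor 1/2 the bound fails (one edge, outputs {1} on G and {2} on G-e determined by the first algorithm: sensitivity 2, H=1, distance 1). *)

theory Defs
  imports "HOL-Probability.Probability"
begin

record 'v ugraph =
  verts :: "'v set"
  edges :: "'v set set"

definition finite_ugraph :: "'v ugraph \<Rightarrow> bool" where
  "finite_ugraph G \<longleftrightarrow> finite (verts G) \<and> edges G \<subseteq> {e. e \<subseteq> verts G \<and> card e = 2}"

definition delete_edge :: "'v ugraph \<Rightarrow> 'v set \<Rightarrow> 'v ugraph" where
  "delete_edge G e = G\<lparr>edges := edges G - {e}\<rparr>"

text \<open>
  A randomized algorithm is a function into probability mass functions.  All distances and
  averages are extended nonnegative reals, so that they are meaningful without boundedness or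
  summability assumptions.

  The cardinality of an infinite set is 0 in HOL; the Hamming distance and the Hamming weight
  are only meant for finite sets.
\<close>

definition hamming_dist :: "'x set \<Rightarrow> 'x set \<Rightarrow> nat" where
  "hamming_dist S T = card (sym_diff S T)"

definition couplings :: "'a pmf \<Rightarrow> 'b pmf \<Rightarrow> ('a \<times> 'b) pmf set" where
  "couplings p q = {D. map_pmf fst D = p \<and> map_pmf snd D = q}"

definition d_EM :: "'x set pmf \<Rightarrow> 'x set pmf \<Rightarrow> ennreal" where
  "d_EM p q = (INF D\<in>couplings p q.
     \<integral>\<^sup>+ (S, T). of_nat (hamming_dist S T) \<partial>measure_pmf D)"

text \<open>
  Total variation distance in the measure-theoretic normalization, that is, the total variation
  \<open>|p - q|(\<Omega>)\<close> of the signed measure \<open>p - q\<close>, with values in \<open>[0, 2]\<close>.  With the other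
  common normalization, which halves this value, the composition bound fails: let \<open>G\<close> have a
  single edge \<open>e\<close>, let the first algorithm return its input graph, and let the second one
  ignore the graph and map \<open>G\<close> to \<open>{a}\<close> and \<open>G - e\<close> to \<open>{b}\<close> with \<open>a \<noteq> b\<close>.  The
  composition then has average sensitivity 2, whereas the maximum Hamming weight is 1, the
  halved total variation distance is 1, and the second algorithm has average sensitivity 0.
\<close>

definition d_TV :: "'a pmf \<Rightarrow> 'a pmf \<Rightarrow> ennreal" where
  "d_TV p q = (\<integral>\<^sup>+ x. ennreal \<bar>pmf p x - pmf q x\<bar> \<partial>count_space UNIV)"

text \<open>
  If \<open>G\<close> has no edges, the uniform distribution on its edges does not exist; since then
  \<open>delete_edge G e = G\<close> for every \<open>e\<close>, the average sensitivity below is the distance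
  between \<open>B G\<close> and itself.
\<close>

definition average_sensitivity ::
    "('b pmf \<Rightarrow> 'b pmf \<Rightarrow> ennreal) \<Rightarrow> ('v ugraph \<Rightarrow> 'b pmf) \<Rightarrow> 'v ugraph \<Rightarrow> ennreal" where
  "average_sensitivity d B G =
     (\<integral>\<^sup>+ e. d (B G) (B (delete_edge G e)) \<partial>measure_pmf (pmf_of_set (edges G)))"

text \<open>
  The solutions obtainable by running \<open>B\<close> on \<open>G\<close> and on the graphs \<open>G - e\<close>, and the
  maximum of their Hamming weights.  The supremum is taken in the extended nonnegative reals; it is
  the maximum whenever the weights are bounded, and infinite otherwise.
\<close>

definition obtainable_solutions :: "('v ugraph \<Rightarrow> 'x set pmf) \<Rightarrow> 'v ugraph \<Rightarrow> 'x set set" where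
  "obtainable_solutions B G = set_pmf (B G) \<union> (\<Union>e\<in>edges G. set_pmf (B (delete_edge G e)))"

definition max_hamming_weight :: "('v ugraph \<Rightarrow> 'x set pmf) \<Rightarrow> 'v ugraph \<Rightarrow> ennreal" where
  "max_hamming_weight B G = (SUP S\<in>obtainable_solutions B G. of_nat (card S))"

end

theory Submission
  imports Defs
begin

text \<open>
  Couple the outputs of \<open>A1 G\<close> and \<open>A1 (G - e)\<close> maximally, so that they differ with
  probability half the (unhalved) total variation distance.  Where they agree, run \<open>A2\<close> under
  an almost optimal coupling; where they differ, run it independently, at a cost of at most
  \<open>2 H\<close>.  Averaging over \<open>e\<close> gives the bound.
\<close>

section \<open>Total variation as excess mass\<close>

text \<open>The positive and the negative part of \<open>p - q\<close> have equal mass: each of them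
  plus 1 is the mass of the pointwise maximum, which is symmetric in \<open>p\<close> and
  \<open>q\<close>. Adding 1 avoids subtraction in \<open>ennreal\<close>.\<close>

lemma d_TV_eq_excess:
  "d_TV p q = 2 * (\<integral>\<^sup>+x. ennreal (max 0 (pmf p x - pmf q x)) \<partial>count_space UNIV)"
    (is "_ = 2 * ?P p q")
proof -
  have max: "?P p q + 1 = (\<integral>\<^sup>+x. ennreal (max (pmf p x) (pmf q x)) \<partial>count_space UNIV)"
    for p q :: "'a pmf"
  proof -
    have "?P p q + 1 = ?P p q + (\<integral>\<^sup>+x. ennreal (pmf q x) \<partial>count_space UNIV)"
      by (simp add: nn_integral_pmf)
    also have "\<dots> = (\<integral>\<^sup>+x. ennreal (max 0 (pmf p x - pmf q x)) + ennreal (pmf q x)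
        \<partial>count_space UNIV)"
      by (simp add: nn_integral_add)
    also have "\<dots> = (\<integral>\<^sup>+x. ennreal (max (pmf p x) (pmf q x)) \<partial>count_space UNIV)"
      by (intro nn_integral_cong) (simp flip: ennreal_plus add: max_def)
    finally show ?thesis .
  qed
  have "?P p q + 1 = ?P q p + 1"
    using max[of p q] max[of q p] by (simp add: max.commute)
  then have sym: "?P p q = ?P q p" by simp
  have "d_TV p q = (\<integral>\<^sup>+x. ennreal (max 0 (pmf p x - pmf q x))
      + ennreal (max 0 (pmf q x - pmf p x)) \<partial>count_space UNIV)"
    unfolding d_TV_def
    by (intro nn_integral_cong) (simp flip: ennreal_plus add: max_def)
  also have "\<dots> = ?P p q + ?P q p"
    by (simp add: nn_integral_add)
  finally show ?thesis using sym by (simp add: mult_2)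
qed

lemma d_TV_commute: "d_TV p q = d_TV q p"
  unfolding d_TV_def by (simp add: abs_minus_commute)

lemma d_TV_eq_0_imp_eq:
  assumes "d_TV p q = 0"
  shows "p = q"
proof (rule pmf_eqI)
  fix x
  have "ennreal \<bar>pmf p x - pmf q x\<bar> = 0"
    using assms unfolding d_TV_def by (subst (asm) nn_integral_0_iff_AE) (auto simp: AE_count_space)
  then show "pmf p x = pmf q x" by simp
qed

text \<open>The excess of \<open>p\<close> over \<open>q\<close> lies below \<open>p\<close>, whose
  mass is 1. The resulting finiteness allows the distance to be treated as a real number.\<close>

lemma d_TV_le_2: "d_TV p q \<le> 2"
proof -
  have "(\<integral>\<^sup>+x. ennreal (max 0 (pmf p x - pmf q x)) \<partial>count_space UNIV)
      \<le> (\<integral>\<^sup>+x. ennreal (pmf p x) \<partial>count_space UNIV)"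
    by (intro nn_integral_mono ennreal_leI) simp
  then have "(\<integral>\<^sup>+x. ennreal (max 0 (pmf p x - pmf q x)) \<partial>count_space UNIV) \<le> 1"
    by (simp add: nn_integral_pmf)
  then show ?thesis
    unfolding d_TV_eq_excess using mult_left_mono[of _ 1 "2::ennreal"] by simp
qed

section \<open>The maximal coupling\<close>

text \<open>At each point \<open>s\<close> the mass \<open>min (pmf p s) (pmf q s)\<close> can stay
  on the diagonal. What remains of \<open>p\<close> is its excess over \<open>q\<close>, with mass
  half of \<open>d_TV p q\<close>. The case \<open>p = q\<close> is separate because the excess is
  normalized by division.\<close>

lemma exists_maximal_coupling:
  fixes p q :: "'a pmf"
  shows "\<exists>C\<in>couplings p q. 2 * emeasure (measure_pmf C) {x. fst x \<noteq> snd x} \<le> d_TV p q"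
proof (cases "p = q")
  case True
  have "map_pmf (\<lambda>s. (s, s)) p \<in> couplings p q"
    using True by (simp add: couplings_def map_pmf_comp)
  moreover have "emeasure (measure_pmf (map_pmf (\<lambda>s. (s, s)) p)) {x. fst x \<noteq> snd x} = 0"
    by simp
  ultimately show ?thesis by (metis mult_zero_right zero_le)
next
  case False
  \<comment> \<open>Since \<open>ennreal\<close> truncates negative numbers, simp would erase
    \<open>max 0\<close>. It is kept because the same excess also occurs in real arithmetic, where
    it matters.\<close>
  note ennreal_max_0 [simp del] ennreal_max_0' [simp del]
  define \<delta> where "\<delta> = enn2real (d_TV p q) / 2"
  have "d_TV p q < \<top>"
    using d_TV_le_2[of p q] by (simp add: le_less_trans)
  then have TV: "d_TV p q = 2 * ennreal \<delta>"
    unfolding \<delta>_def by (simp flip: ennreal_numeral ennreal_mult' ennreal_mult'')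
  have "\<delta> \<ge> 0" by (simp add: \<delta>_def)
  then have \<delta>_pos: "\<delta> > 0"
    using TV False d_TV_eq_0_imp_eq[of p q] by (cases "\<delta> = 0") auto
  have cancel: "a = ennreal \<delta>" if "2 * a = 2 * ennreal \<delta>" for a
    using that by (simp add: ennreal_mult_cancel_left)
  have excess_p: "(\<integral>\<^sup>+x. ennreal (max 0 (pmf p x - pmf q x)) \<partial>count_space UNIV) = ennreal \<delta>"
    by (rule cancel) (simp flip: TV add: d_TV_eq_excess)
  \<comment> \<open>By symmetry of \<open>d_TV\<close> both excesses have mass
    \<open>\<delta>\<close>, so the surplus taken from \<open>p\<close> exactly fills the deficit
    with respect to \<open>q\<close>.\<close>
  have excess_q: "(\<integral>\<^sup>+x. ennreal (max 0 (pmf q x - pmf p x)) \<partial>count_space UNIV) = ennreal \<delta>"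
    by (rule cancel) (metis TV d_TV_eq_excess d_TV_commute)

  text \<open>Draw \<open>s\<close> from \<open>p\<close>, keep it with probability \<open>min (p s) (q s) / p s\<close>, and
    otherwise redraw it from the normalized excess of \<open>q\<close> over \<open>p\<close>.\<close>

  define Q where "Q = embed_pmf (\<lambda>x. max 0 (pmf q x - pmf p x) / \<delta>)"
  have "(\<integral>\<^sup>+x. ennreal (max 0 (pmf q x - pmf p x) / \<delta>) \<partial>count_space UNIV)
      = (\<integral>\<^sup>+x. ennreal (max 0 (pmf q x - pmf p x)) * ennreal (1 / \<delta>) \<partial>count_space UNIV)"
    using \<delta>_pos by (intro nn_integral_cong) (simp flip: ennreal_mult)
  also have "\<dots> = ennreal \<delta> * ennreal (1 / \<delta>)"
    by (simp add: nn_integral_multc excess_q)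
  also have "\<dots> = 1"
    using \<delta>_pos by (simp flip: ennreal_mult)
  finally have pmf_Q: "pmf Q x = max 0 (pmf q x - pmf p x) / \<delta>" for x
    unfolding Q_def using \<delta>_pos by (intro pmf_embed_pmf) auto
  define r where "r s = min (pmf p s) (pmf q s) / pmf p s" for s
  have r01: "0 \<le> r s" "r s \<le> 1" for s
    by (auto simp: r_def divide_le_eq_1 less_le)
  \<comment> \<open>If \<open>pmf p s = 0\<close>, division by zero gives \<open>r s = 0\<close>,
    and the minimum vanishes as well.\<close>
  have p_keep: "pmf p s * r s = min (pmf p s) (pmf q s)" for s
    using pmf_nonneg[of q s] by (auto simp: r_def min_def)
  have p_redraw: "pmf p s * (1 - r s) = max 0 (pmf p s - pmf q s)" for s
    by (simp add: right_diff_distrib p_keep)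
  define K where "K s = bernoulli_pmf (r s) \<bind> (\<lambda>b. if b then return_pmf s else Q)" for s
  define C where "C = p \<bind> (\<lambda>s. map_pmf (Pair s) (K s))"

  have pmf_K: "pmf (K s) t = r s * indicator {t} s + (1 - r s) * pmf Q t" for s t
    using r01[of s] by (simp add: K_def pmf_bind indicator_def)
  \<comment> \<open>This is the second marginal of \<open>C\<close>. At \<open>t\<close>, kept mass
    contributes \<open>min (pmf p t) (pmf q t)\<close> and redrawn mass contributes
    \<open>\<delta> * pmf Q t\<close>, the excess of \<open>q\<close> over \<open>p\<close>;
    together they give \<open>pmf q t\<close>.\<close>
  have "p \<bind> K = q"
  proof (rule pmf_eqI)
    fix t
    have "ennreal (pmf (p \<bind> K) t)
        = (\<integral>\<^sup>+s. ennreal (pmf p s) * ennreal (pmf (K s) t) \<partial>count_space UNIV)"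
      by (simp add: ennreal_pmf_bind nn_integral_measure_pmf)
    also have "\<dots> = (\<integral>\<^sup>+s. ennreal (min (pmf p t) (pmf q t)) * indicator {t} s
        + ennreal (max 0 (pmf p s - pmf q s)) * ennreal (pmf Q t) \<partial>count_space UNIV)"
    proof (intro nn_integral_cong)
      fix s
      have "pmf p s * pmf (K s) t
          = min (pmf p s) (pmf q s) * indicator {t} s + max 0 (pmf p s - pmf q s) * pmf Q t"
        by (simp add: pmf_K distrib_left flip: p_keep p_redraw)
      then have "ennreal (pmf p s) * ennreal (pmf (K s) t)
          = ennreal (min (pmf p s) (pmf q s) * indicator {t} s)
            + ennreal (max 0 (pmf p s - pmf q s) * pmf Q t)"
        by (simp flip: ennreal_mult ennreal_plus)
      then show "ennreal (pmf p s) * ennreal (pmf (K s) t)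
          = ennreal (min (pmf p t) (pmf q t)) * indicator {t} s
            + ennreal (max 0 (pmf p s - pmf q s)) * ennreal (pmf Q t)"
        by (auto simp: ennreal_mult indicator_def)
    qed
    also have "\<dots> = ennreal (min (pmf p t) (pmf q t)) + ennreal \<delta> * ennreal (pmf Q t)"
      by (simp add: nn_integral_add nn_integral_cmult nn_integral_multc excess_p
          one_ennreal_def[symmetric])
    also have "\<dots> = ennreal (min (pmf p t) (pmf q t) + \<delta> * pmf Q t)"
      using \<delta>_pos by (simp add: ennreal_mult)
    also have "min (pmf p t) (pmf q t) + \<delta> * pmf Q t = pmf q t"
      using \<delta>_pos by (simp add: pmf_Q)
    finally show "pmf (p \<bind> K) t = pmf q t" by simp
  qed
  then have coupling: "C \<in> couplings p q"
    by (simp add: couplings_def C_def map_bind_pmf map_pmf_comp bind_return_pmf')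

  \<comment> \<open>The coordinates can differ only after a redraw, which has probability
    \<open>1 - r s\<close>.\<close>
  have differ: "emeasure (measure_pmf (K s)) {t. s \<noteq> t} \<le> ennreal (1 - r s)" for s
  proof -
    have "emeasure (measure_pmf (K s)) {t. s \<noteq> t}
        = ennreal (1 - r s) * emeasure (measure_pmf Q) {t. s \<noteq> t}"
      using r01[of s] by (simp add: K_def emeasure_bind_pmf mult.commute)
    also have "\<dots> \<le> ennreal (1 - r s) * 1"
      by (intro mult_left_mono measure_pmf.emeasure_le_1) simp
    finally show ?thesis by simp
  qed
  have "emeasure (measure_pmf C) {x. fst x \<noteq> snd x}
      = (\<integral>\<^sup>+s. emeasure (measure_pmf (K s)) {t. s \<noteq> t} \<partial>measure_pmf p)"
    by (simp add: C_def emeasure_bind_pmf vimage_def)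
  also have "\<dots> \<le> (\<integral>\<^sup>+s. ennreal (1 - r s) \<partial>measure_pmf p)"
    by (intro nn_integral_mono differ)
  also have "\<dots> = (\<integral>\<^sup>+s. ennreal (max 0 (pmf p s - pmf q s)) \<partial>count_space UNIV)"
    using r01 by (simp add: nn_integral_measure_pmf flip: p_redraw ennreal_mult)
  finally have "2 * emeasure (measure_pmf C) {x. fst x \<noteq> snd x} \<le> 2 * ennreal \<delta>"
    unfolding excess_p by (intro mult_left_mono) auto
  then show ?thesis
    using coupling TV by auto
qed

section \<open>Couplings and the earth mover's distance\<close>

lemma pair_pmf_in_couplings: "pair_pmf p q \<in> couplings p q"
  by (simp add: couplings_def map_fst_pair_pmf map_snd_pair_pmf)

lemma coupling_set_pmfD:
  assumes "C \<in> couplings p q" "x \<in> set_pmf C"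
  shows "fst x \<in> set_pmf p" "snd x \<in> set_pmf q"
  using assms by (auto simp: couplings_def)

text \<open>Working up to \<open>\<epsilon>\<close> avoids proving that the infimum is attained. If
  the distance is infinite, the independent coupling will do.\<close>

lemma exists_coupling_le_d_EM:
  assumes "\<epsilon> > 0"
  shows "\<exists>D\<in>couplings p q.
    (\<integral>\<^sup>+(S, T). of_nat (hamming_dist S T) \<partial>measure_pmf D) \<le> d_EM p q + ennreal \<epsilon>"
proof (cases "d_EM p q = \<top>")
  case True
  then show ?thesis using pair_pmf_in_couplings[of p q] by auto
next
  case False
  then have "d_EM p q < d_EM p q + ennreal \<epsilon>"
    using assms by (simp add: ennreal_add_left_cancel_less less_top)
  then show ?thesis
    unfolding d_EM_def[of p q, THEN eq_reflection] INF_less_iff by (meson less_imp_le)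
qed

lemma d_EM_le:
  assumes "D \<in> couplings p q"
  shows "d_EM p q \<le> (\<integral>\<^sup>+(S, T). of_nat (hamming_dist S T) \<partial>measure_pmf D)"
  unfolding d_EM_def using assms by (rule INF_lower)

lemma d_EM_self: "d_EM p p = 0"
proof -
  have "map_pmf (\<lambda>s. (s, s)) p \<in> couplings p p"
    by (simp add: couplings_def map_pmf_comp)
  from d_EM_le[OF this] show ?thesis
    by (simp add: hamming_dist_def)
qed

lemma hamming_dist_le:
  assumes "finite S" "finite T"
  shows "hamming_dist S T \<le> card S + card T"
proof -
  have "hamming_dist S T \<le> card (S \<union> T)"
    unfolding hamming_dist_def using assms by (intro card_mono) auto
  also have "\<dots> \<le> card S + card T" by (rule card_Un_le)
  finally show ?thesis .
qed

text \<open>This is the composition bound for a single deleted edge. The cost \<open>2 * H\<close>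
  off the diagonal meets a probability of at most half of \<open>d_TV p q\<close>, so the factor 2
  cancels.\<close>

lemma d_EM_bind_pmf_le:
  fixes p q :: "'a pmf" and f g :: "'a \<Rightarrow> 'x set pmf"
  assumes f: "\<And>s S. s \<in> set_pmf p \<Longrightarrow> S \<in> set_pmf (f s) \<Longrightarrow> finite S \<and> of_nat (card S) \<le> H"
    and g: "\<And>s S. s \<in> set_pmf q \<Longrightarrow> S \<in> set_pmf (g s) \<Longrightarrow> finite S \<and> of_nat (card S) \<le> H"
  shows "d_EM (p \<bind> f) (q \<bind> g)
    \<le> H * d_TV p q + (\<integral>\<^sup>+s. d_EM (f s) (g s) \<partial>measure_pmf p)"
proof (rule ennreal_le_epsilon)
  fix \<epsilon> :: real
  assume "\<epsilon> > 0"
  then have "\<exists>D. \<forall>s. D s \<in> couplings (f s) (g s)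
      \<and> (\<integral>\<^sup>+(S, T). of_nat (hamming_dist S T) \<partial>measure_pmf (D s))
        \<le> d_EM (f s) (g s) + ennreal \<epsilon>"
    by (intro choice allI) (use exists_coupling_le_d_EM in blast)
  then obtain D where D: "\<And>s. D s \<in> couplings (f s) (g s)"
    and D_le: "\<And>s. (\<integral>\<^sup>+(S, T). of_nat (hamming_dist S T) \<partial>measure_pmf (D s))
        \<le> d_EM (f s) (g s) + ennreal \<epsilon>"
    by blast
  obtain C where C: "C \<in> couplings p q"
    and C_le: "2 * emeasure (measure_pmf C) {x. fst x \<noteq> snd x} \<le> d_TV p q"
    using exists_maximal_coupling by blast
  define E where
    "E x = (if fst x = snd x then D (fst x) else pair_pmf (f (fst x)) (g (snd x)))" for x
  \<comment> \<open>Each marginal of \<open>E x\<close> depends on only one coordinate of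
    \<open>x\<close>. Hence mixing \<open>E\<close> over a coupling of \<open>p\<close> and
    \<open>q\<close> couples the two mixtures.\<close>
  have E: "E x \<in> couplings (f (fst x)) (g (snd x))" for x
    using D[of "fst x"] pair_pmf_in_couplings by (auto simp: E_def)
  then have "map_pmf fst (C \<bind> E) = map_pmf fst C \<bind> f"
    "map_pmf snd (C \<bind> E) = map_pmf snd C \<bind> g"
    by (simp_all add: couplings_def map_bind_pmf bind_map_pmf)
  then have "C \<bind> E \<in> couplings (p \<bind> f) (q \<bind> g)"
    using C by (simp add: couplings_def)
  then have "d_EM (p \<bind> f) (q \<bind> g)
      \<le> (\<integral>\<^sup>+(S, T). of_nat (hamming_dist S T) \<partial>measure_pmf (C \<bind> E))"
    by (rule d_EM_le)
  also have "\<dots> = (\<integral>\<^sup>+x. (\<integral>\<^sup>+(S, T). of_nat (hamming_dist S T) \<partial>measure_pmf (E x))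
      \<partial>measure_pmf C)"
    by (rule nn_integral_bind_pmf)
  \<comment> \<open>The distance term is charged off the diagonal too. It then depends on
    \<open>fst x\<close> alone, and its integral over \<open>C\<close> becomes one over
    \<open>p\<close>.\<close>
  also have "\<dots> \<le> (\<integral>\<^sup>+x. H * (2 * indicator {x. fst x \<noteq> snd x} x)
      + (d_EM (f (fst x)) (g (fst x)) + ennreal \<epsilon>) \<partial>measure_pmf C)"
  proof (intro nn_integral_mono_AE AE_pmfI)
    fix x
    assume x: "x \<in> set_pmf C"
    show "(\<integral>\<^sup>+(S, T). of_nat (hamming_dist S T) \<partial>measure_pmf (E x))
      \<le> H * (2 * indicator {x. fst x \<noteq> snd x} x)
        + (d_EM (f (fst x)) (g (fst x)) + ennreal \<epsilon>)"
    proof (cases "fst x = snd x")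
      case True
      then show ?thesis using D_le[of "fst x"] by (simp add: E_def)
    next
      case False
      have "(\<integral>\<^sup>+(S, T). of_nat (hamming_dist S T) \<partial>measure_pmf (E x))
          \<le> (\<integral>\<^sup>+y. H * 2 \<partial>measure_pmf (E x))"
      proof (intro nn_integral_mono_AE AE_pmfI)
        fix y
        assume y: "y \<in> set_pmf (E x)"
        have S: "finite (fst y) \<and> of_nat (card (fst y)) \<le> H"
          and T: "finite (snd y) \<and> of_nat (card (snd y)) \<le> H"
          using f g coupling_set_pmfD[OF C x] coupling_set_pmfD[OF E y] by blast+
        have "(of_nat (hamming_dist (fst y) (snd y)) :: ennreal)
            \<le> of_nat (card (fst y) + card (snd y))"
          using S T by (intro of_nat_mono hamming_dist_le) auto
        also have "\<dots> \<le> H + H"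
          unfolding of_nat_add using S T by (intro add_mono) auto
        finally show "(case y of (S, T) \<Rightarrow> of_nat (hamming_dist S T)) \<le> H * 2"
          by (simp add: case_prod_beta mult_2_right)
      qed
      also have "\<dots> = H * 2" by simp
      finally show ?thesis using False by (simp add: add_increasing2)
    qed
  qed
  also have "\<dots> = H * (2 * emeasure (measure_pmf C) {x. fst x \<noteq> snd x})
      + ((\<integral>\<^sup>+x. d_EM (f (fst x)) (g (fst x)) \<partial>measure_pmf C) + ennreal \<epsilon>)"
    by (simp add: nn_integral_add nn_integral_cmult)
  also have "(\<integral>\<^sup>+x. d_EM (f (fst x)) (g (fst x)) \<partial>measure_pmf C)
      = (\<integral>\<^sup>+s. d_EM (f s) (g s) \<partial>measure_pmf (map_pmf fst C))"
    by simp
  also have "map_pmf fst C = p"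
    using C by (simp add: couplings_def)
  also have "H * (2 * emeasure (measure_pmf C) {x. fst x \<noteq> snd x})
      + ((\<integral>\<^sup>+s. d_EM (f s) (g s) \<partial>measure_pmf p) + ennreal \<epsilon>)
      \<le> H * d_TV p q + ((\<integral>\<^sup>+s. d_EM (f s) (g s) \<partial>measure_pmf p) + ennreal \<epsilon>)"
    using C_le by (intro add_right_mono mult_left_mono) auto
  finally show "d_EM (p \<bind> f) (q \<bind> g)
      \<le> H * d_TV p q + (\<integral>\<^sup>+s. d_EM (f s) (g s) \<partial>measure_pmf p) + ennreal \<epsilon>"
    by (simp add: add.assoc)
qed

section \<open>Averaging over the deleted edge\<close>

lemma finite_edges: "finite_ugraph G \<Longrightarrow> finite (edges G)"
  by (rule finite_subset[of _ "Pow (verts G)"]) (auto simp: finite_ugraph_def)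

lemma finite_ugraph_delete_edge: "finite_ugraph G \<Longrightarrow> finite_ugraph (delete_edge G e)"
  by (auto simp: finite_ugraph_def delete_edge_def)

text \<open>Both sides are integrals over a product pmf, up to exchanging coordinates. Every
  function is measurable there, so \<open>f\<close> can be arbitrary.\<close>

lemma nn_integral_measure_pmf_swap:
  "(\<integral>\<^sup>+x. (\<integral>\<^sup>+y. f x y \<partial>measure_pmf q) \<partial>measure_pmf p)
    = (\<integral>\<^sup>+y. (\<integral>\<^sup>+x. f x y \<partial>measure_pmf p) \<partial>measure_pmf q)"
proof -
  have "(\<integral>\<^sup>+x. (\<integral>\<^sup>+y. f x y \<partial>measure_pmf q) \<partial>measure_pmf p)
      = (\<integral>\<^sup>+z. f (fst z) (snd z) \<partial>measure_pmf (pair_pmf p q))"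
    by (simp add: nn_integral_pair_pmf')
  also have "\<dots> = (\<integral>\<^sup>+z. f (snd z) (fst z) \<partial>measure_pmf (pair_pmf q p))"
    by (subst pair_commute_pmf) (simp add: case_prod_beta)
  also have "\<dots> = (\<integral>\<^sup>+y. (\<integral>\<^sup>+x. f x y \<partial>measure_pmf p) \<partial>measure_pmf q)"
    by (simp add: nn_integral_pair_pmf')
  finally show ?thesis .
qed

theorem mainTheorem2:
  fixes A1 :: "'v ugraph \<Rightarrow> 's1 pmf"
    and A2 :: "'v ugraph \<Rightarrow> 's1 \<Rightarrow> 'x set pmf"
    and A :: "'v ugraph \<Rightarrow> 'x set pmf"
    and \<gamma>1 :: "'v ugraph \<Rightarrow> ennreal"
    and \<beta>2 :: "'s1 \<Rightarrow> 'v ugraph \<Rightarrow> ennreal"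
    and G :: "'v ugraph"
  assumes finite_solutions:
      "\<And>G S1 S2. finite_ugraph G \<Longrightarrow> S2 \<in> set_pmf (A2 G S1) \<Longrightarrow> finite S2"
    and sensitivity_A1:
      "\<And>G. finite_ugraph G \<Longrightarrow> average_sensitivity d_TV A1 G = \<gamma>1 G"
    and sensitivity_A2:
      "\<And>S1 G. finite_ugraph G \<Longrightarrow> average_sensitivity d_EM (\<lambda>G'. A2 G' S1) G = \<beta>2 S1 G"
    and composition:
      "\<And>G. finite_ugraph G \<Longrightarrow> A G = bind_pmf (A1 G) (\<lambda>S1. A2 G S1)"
    and graph: "finite_ugraph G"
  shows "average_sensitivity d_EM A G
    \<le> max_hamming_weight A G * \<gamma>1 G + (\<integral>\<^sup>+ S1. \<beta>2 S1 G \<partial>measure_pmf (A1 G))"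
\<comment> \<open>Without edges \<open>pmf_of_set\<close> is unspecified, but every deletion returns
  \<open>G\<close>, so the left side is 0 whatever distribution it denotes.\<close>
proof (cases "edges G = {}")
  case True
  then have "delete_edge G e = G" for e
    by (simp add: delete_edge_def)
  then show ?thesis
    by (simp add: average_sensitivity_def d_EM_self)
next
  case False
  let ?U = "measure_pmf (pmf_of_set (edges G))"
  let ?H = "max_hamming_weight A G"
  have H: "of_nat (card S) \<le> ?H" if "S \<in> obtainable_solutions A G" for S
    unfolding max_hamming_weight_def using that by (rule SUP_upper)
  have step: "d_EM (A G) (A (delete_edge G e)) \<le> ?H * d_TV (A1 G) (A1 (delete_edge G e))
      + (\<integral>\<^sup>+S1. d_EM (A2 G S1) (A2 (delete_edge G e) S1) \<partial>measure_pmf (A1 G))"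
    if "e \<in> edges G" for e
  proof -
    let ?G = "delete_edge G e"
    have G': "finite_ugraph ?G"
      using graph by (rule finite_ugraph_delete_edge)
    \<comment> \<open>Outputs of \<open>A2\<close> on seeds drawn from \<open>A1\<close>, for
      \<open>G\<close> and for \<open>G - e\<close>, are outputs of \<open>A\<close>. So
      \<open>?H\<close> bounds the weights in both mixtures.\<close>
    have "S \<in> obtainable_solutions A G"
      if "s \<in> set_pmf (A1 G)" "S \<in> set_pmf (A2 G s)" for s S
      using that by (auto simp: obtainable_solutions_def composition[OF graph])
    moreover have "S \<in> obtainable_solutions A G"
      if "s \<in> set_pmf (A1 ?G)" "S \<in> set_pmf (A2 ?G s)" for s S
    proof -
      have "S \<in> set_pmf (A ?G)"
        using that by (auto simp: composition[OF G'])
      then show ?thesis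
        using \<open>e \<in> edges G\<close> by (auto simp: obtainable_solutions_def)
    qed
    ultimately show ?thesis
      unfolding composition[OF G'] composition[OF graph]
      using H finite_solutions[OF graph] finite_solutions[OF G']
      by (intro d_EM_bind_pmf_le) (simp_all flip: composition[OF graph])
  qed
  have "average_sensitivity d_EM A G
      \<le> (\<integral>\<^sup>+e. ?H * d_TV (A1 G) (A1 (delete_edge G e))
        + (\<integral>\<^sup>+S1. d_EM (A2 G S1) (A2 (delete_edge G e) S1) \<partial>measure_pmf (A1 G)) \<partial>?U)"
    unfolding average_sensitivity_def using step False finite_edges[OF graph]
    by (intro nn_integral_mono_AE AE_pmfI) simp
  \<comment> \<open>Exchanging the averages over \<open>e\<close> and \<open>S1\<close> leaves, for
    each fixed \<open>S1\<close>, the average sensitivity of \<open>A2\<close> with that argument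
    held fixed.\<close>
  also have "\<dots> = ?H * average_sensitivity d_TV A1 G
      + (\<integral>\<^sup>+S1. average_sensitivity d_EM (\<lambda>G'. A2 G' S1) G \<partial>measure_pmf (A1 G))"
    unfolding average_sensitivity_def
    by (simp add: nn_integral_add nn_integral_cmult
        nn_integral_measure_pmf_swap[where p = "pmf_of_set (edges G)"])
  finally show ?thesis
    by (simp add: sensitivity_A1[OF graph] sensitivity_A2[OF graph])
qed

end
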